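(* Let $k\ge 2$ be a natural number and let $S$ be a $k$-automatic subset of $\mathbb{N}$. Then $S$ forms an asymptotic additive basis for $\mathbb{N}$ if and only if the following conditions both hold: (1) $S$ is not sparse; (2) $\gcd(S)=1$. Moreover, if $S$ is non-sparse and $\gcd(S)=1$, then there exist effectively computable constants $M$ and $N$ such that every natural number greater than or equal to $M$ can be expressed as the sum of at most $N$ elements of $S$.
   Context: $\mathbb{N}=\{0,1,2,\ldots\}$. The canonical base-$k$ expansion of $n\in\mathbb{N}$ is the word over $\{0,1,\ldots,k-1\}$ representing $n$ in base $k$ without leading zeros (the empty word for $n=0$). A set $S\subseteq\mathbb{N}$ is $k$-automatic if the language of canonical base-$k$ expansions of its elements is regular, i.e., accepted by a deterministic finite automaton (DFA); by convention expansions are read by automata starting with the least significant digit. $S$ is an asymptotic additive basis for $\mathbb{N}$ if there exists a constant $j$ such that every sufficiently large natural number can be written as a sum of at most $j$ members of $S$ (repetitions allowed). Let $\pi_S(x)=\#\{n\le x : n\in S\}$. $S$ is sparse if there is an integer $d\ge 0$ with $\pi_S(x)=O((\log x)^d)$; otherwise $S$ is non-sparse. $\gcd(S)$ is the greatest common divisor of all elements of $S$. "Effectively computable" means computable by an algorithm from $k$ and a DFA accepting the base-$k$ expansions of elements of $S$. *)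

theory Defs
  imports Complex_Main "HOL-Library.Landau_Symbols" "HOL-Library.Nat_Bijection"
begin

section \<open>Automatic sets\<close>

text \<open>Canonical base-\<open>k\<close> expansion, least significant digit first, so the absence of leading zeros
  means that the \<^emph>\<open>last\<close> entry is nonzero. Meaningful for \<open>k \<ge> 2\<close>; the guard only ensures
  termination.\<close>

fun base_expansion :: "nat \<Rightarrow> nat \<Rightarrow> nat list" where
  "base_expansion k n =
     (if k < 2 \<or> n = 0 then [] else (n mod k) # base_expansion k (n div k))"

declare base_expansion.simps [simp del]

lemma base_expansion_0 [simp]: "base_expansion k 0 = []"
  by (simp add: base_expansion.simps)

lemma base_expansion_canonical:
  assumes "2 \<le> k"
  shows "set (base_expansion k n) \<subseteq> {..<k}"
    and "horner_sum id k (base_expansion k n) = n"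
    and "n \<noteq> 0 \<Longrightarrow> base_expansion k n \<noteq> [] \<and> last (base_expansion k n) \<noteq> 0"
proof -
  have "set (base_expansion k n) \<subseteq> {..<k} \<and> horner_sum id k (base_expansion k n) = n \<and>
    (n \<noteq> 0 \<longrightarrow> base_expansion k n \<noteq> [] \<and> last (base_expansion k n) \<noteq> 0)"
  proof (induction n rule: less_induct)
    case (less n)
    show ?case
    proof (cases "n = 0")
      case False
      have "n div k < n" using False assms by simp
      note IH = less.IH[OF this]
      have e: "base_expansion k n = (n mod k) # base_expansion k (n div k)"
        using False assms by (subst base_expansion.simps) simp
      show ?thesis
      proof (cases "n div k = 0")
        case True
        then have "n < k" using assms by (simp add: div_eq_0_iff)
        then show ?thesis using e True False by simp
      next
        case nz: False
        then show ?thesis using e IH assms by simp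
      qed
    qed simp
  qed
  then show "set (base_expansion k n) \<subseteq> {..<k}"
    and "horner_sum id k (base_expansion k n) = n"
    and "n \<noteq> 0 \<Longrightarrow> base_expansion k n \<noteq> [] \<and> last (base_expansion k n) \<noteq> 0"
    by auto
qed

text \<open>States are \<open>0, \<dots>, num_states A - 1\<close> and the alphabet is \<open>{0, \<dots>, k - 1}\<close>; values of
  \<open>next_state\<close> outside this range are irrelevant.\<close>

record dfa =
  num_states :: nat
  init_state :: nat
  next_state :: "nat \<Rightarrow> nat \<Rightarrow> nat"
  accepting :: "nat set"

definition is_dfa :: "nat \<Rightarrow> dfa \<Rightarrow> bool" where
  "is_dfa k A \<longleftrightarrow>
     init_state A < num_states A \<and>
     (\<forall>q<num_states A. \<forall>a<k. next_state A q a < num_states A) \<and>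
     accepting A \<subseteq> {..<num_states A}"

definition dfa_language :: "nat \<Rightarrow> dfa \<Rightarrow> nat list set" where
  "dfa_language k A =
     {w \<in> lists {..<k}. foldl (next_state A) (init_state A) w \<in> accepting A}"

definition recognizes :: "nat \<Rightarrow> dfa \<Rightarrow> nat set \<Rightarrow> bool" where
  "recognizes k A S \<longleftrightarrow> is_dfa k A \<and> dfa_language k A = base_expansion k ` S"

definition automatic :: "nat \<Rightarrow> nat set \<Rightarrow> bool" where
  "automatic k S \<longleftrightarrow> (\<exists>A. recognizes k A S)"

section \<open>Additive bases and sparseness\<close>

definition sum_of_at_most :: "nat \<Rightarrow> nat set \<Rightarrow> nat \<Rightarrow> bool" where
  "sum_of_at_most j S n \<longleftrightarrow> (\<exists>xs. set xs \<subseteq> S \<and> length xs \<le> j \<and> sum_list xs = n)"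

definition asymptotic_additive_basis :: "nat set \<Rightarrow> bool" where
  "asymptotic_additive_basis S \<longleftrightarrow> (\<exists>j. \<forall>\<^sub>F n in sequentially. sum_of_at_most j S n)"

definition counting :: "nat set \<Rightarrow> real \<Rightarrow> nat" where
  "counting S x = card {n \<in> S. real n \<le> x}"

definition sparse :: "nat set \<Rightarrow> bool" where
  "sparse S \<longleftrightarrow> (\<exists>d::nat. (\<lambda>x. real (counting S x)) \<in> O(\<lambda>x. ln x ^ d))"

section \<open>Computability\<close>

text \<open>Kleene's partial recursive functions on tuples of natural numbers: zero, successor,
  projections, composition, primitive recursion and unbounded minimization.
  \<open>rec_eval f xs y\<close> states that \<open>f\<close> halts on input \<open>xs\<close> with value \<open>y\<close>.\<close>

datatype recf = Zero | Succ | Proj nat | Comp recf "recf list" | Prim recf recf | Mu recf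

inductive rec_eval :: "recf \<Rightarrow> nat list \<Rightarrow> nat \<Rightarrow> bool" where
  zero: "rec_eval Zero xs 0"
| succ: "rec_eval Succ [x] (Suc x)"
| proj: "i < length xs \<Longrightarrow> rec_eval (Proj i) xs (xs ! i)"
| comp: "list_all2 (\<lambda>g y. rec_eval g xs y) gs ys \<Longrightarrow> rec_eval f ys z
    \<Longrightarrow> rec_eval (Comp f gs) xs z"
| prim_0: "rec_eval f xs y \<Longrightarrow> rec_eval (Prim f g) (0 # xs) y"
| prim_Suc: "rec_eval (Prim f g) (n # xs) r \<Longrightarrow> rec_eval g (n # r # xs) y
    \<Longrightarrow> rec_eval (Prim f g) (Suc n # xs) y"
| mu: "rec_eval f (y # xs) 0 \<Longrightarrow> (\<forall>z<y. \<exists>v. rec_eval f (z # xs) v \<and> 0 < v)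
    \<Longrightarrow> rec_eval (Mu f) xs y"

inductive_cases rec_eval_ZeroE: "rec_eval Zero xs y"
inductive_cases rec_eval_SuccE: "rec_eval Succ xs y"
inductive_cases rec_eval_ProjE: "rec_eval (Proj i) xs y"
inductive_cases rec_eval_CompE: "rec_eval (Comp f gs) xs y"
inductive_cases rec_eval_Prim_0E: "rec_eval (Prim f g) (0 # xs) y"
inductive_cases rec_eval_Prim_SucE: "rec_eval (Prim f g) (Suc n # xs) y"
inductive_cases rec_eval_MuE: "rec_eval (Mu f) xs y"

lemma rec_eval_deterministic: "rec_eval f xs y \<Longrightarrow> rec_eval f xs z \<Longrightarrow> y = z"
proof (induction f xs y arbitrary: z rule: rec_eval.induct)
  case (comp xs gs ys f z z')
  from comp.prems obtain ys' where
    ys': "list_all2 (\<lambda>g y. rec_eval g xs y) gs ys'" "rec_eval f ys' z'"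
    by (rule rec_eval_CompE)
  have "ys = ys'"
  proof (rule nth_equalityI)
    show "length ys = length ys'"
      using comp.IH(1) ys'(1) by (auto dest!: list_all2_lengthD)
    show "ys ! i = ys' ! i" if "i < length ys" for i
      using comp.IH(1) ys'(1) that by (auto simp: list_all2_conv_all_nth)
  qed
  then show ?case using comp.IH(2) ys'(2) by blast
next
  case (prim_0 f xs y g)
  from prim_0.prems have "rec_eval f xs z" by (rule rec_eval_Prim_0E)
  then show ?case by (rule prim_0.IH)
next
  case (prim_Suc f g n xs r y)
  from prim_Suc.prems obtain r' where r': "rec_eval (Prim f g) (n # xs) r'" "rec_eval g (n # r' # xs) z"
    by (rule rec_eval_Prim_SucE)
  have "r = r'" using prim_Suc.IH(1) r'(1) by blast
  then show ?case using prim_Suc.IH(2) r'(2) by blast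
next
  case (mu f y xs)
  from mu.prems have z: "rec_eval f (z # xs) 0 \<and> (\<forall>u<z. \<exists>v. rec_eval f (u # xs) v \<and> 0 < v)"
    by (rule rec_eval_MuE) blast
  have "\<not> y < z" using z mu.IH(1) by auto
  moreover have "\<not> z < y" using z mu.IH(2) by auto
  ultimately show ?case by simp
next
  case (zero xs)
  then show ?case by (rule rec_eval_ZeroE) simp
next
  case (succ x)
  then show ?case by (rule rec_eval_SuccE) simp
next
  case (proj i xs)
  from proj.prems show ?case by (rule rec_eval_ProjE) simp
qed

text \<open>Presentation of the input (\<open>k\<close>, DFA) as a tuple of numbers: base, number of states, initial
  state, transition table (one row per state) and list of accepting states. The last two are
  lists, turned into numbers by the computable bijection \<^const>\<open>list_encode\<close>.\<close>

definition dfa_input :: "nat \<Rightarrow> dfa \<Rightarrow> nat list" where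
  "dfa_input k A =
     [k, num_states A, init_state A,
      list_encode (map (\<lambda>q. list_encode (map (next_state A q) [0..<k])) [0..<num_states A]),
      list_encode (filter (\<lambda>q. q \<in> accepting A) [0..<num_states A])]"

end

theory Submission
  imports Defs
begin

text \<open>If no useful state of the automaton lies on two distinct loops of equal length, the accepted words
  of length \<open>n\<close> are polynomially many in \<open>n\<close> and the set is sparse. Otherwise two such loops
  \<open>x \<noteq> y\<close> of length \<open>l\<close> yield members \<open>b\<^sub>n + D e\<close>, where \<open>e\<close> runs over the numbers with \<open>n\<close> digits
  \<open>0, 1\<close> in base \<open>K = k ^ l\<close>; sums of \<open>K - 1\<close> such \<open>e\<close> fill \<open>{0..<K ^ n}\<close>, so boundedly many
  members represent all large multiples of \<open>D\<close>. Since the gcd is 1, fewer than \<open>D\<close> members, each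
  bounded by pumping modulo \<open>D\<close>, correct the residue modulo \<open>D\<close>. With \<open>B = k ^ m\<close> for \<open>m\<close>
  states, one gets \<open>D \<le> B\<^sup>3\<close> and bounds that are explicit functions of \<open>B\<close>. Conversely, sums of at most
  \<open>j\<close> members of a sparse set are too few.\<close>

section \<open>Words and their values\<close>

lemma foldl_in:
  assumes "s \<in> Q" "\<And>q a. q \<in> Q \<Longrightarrow> a \<in> A \<Longrightarrow> f q a \<in> Q" "set w \<subseteq> A"
  shows "foldl f s w \<in> Q"
  using assms(1,3) by (induction w arbitrary: s) (auto intro: assms(2))

text \<open>A word with at least \<open>card Q\<close> letters has more prefixes than there are
  states, so two prefixes reach the same state and the factor between them can be cut out. The step
  function is arbitrary because the lemma serves the automaton, addition modulo \<open>D\<close>,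
  and the product of the automaton with counters.\<close>

lemma foldl_shorten:
  assumes "finite Q" "s \<in> Q" "\<And>q a. q \<in> Q \<Longrightarrow> a \<in> A \<Longrightarrow> f q a \<in> Q" "set w \<subseteq> A"
  shows "\<exists>w'. set w' \<subseteq> A \<and> length w' < card Q \<and> foldl f s w' = foldl f s w"
  using assms(4)
proof (induction w rule: length_induct)
  case (1 w)
  show ?case
  proof (cases "length w < card Q")
    case True
    then show ?thesis using 1 by blast
  next
    case False
    let ?g = "\<lambda>i. foldl f s (take i w)"
    have "?g ` {..length w} \<subseteq> Q"
    proof clarify
      fix i
      have "set (take i w) \<subseteq> A"
        using "1.prems" set_take_subset[of i w] by blast
      then show "?g i \<in> Q" using assms(2,3) by (intro foldl_in) auto
    qed
    then have "card (?g ` {..length w}) \<le> card Q"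
      using assms(1) card_mono by blast
    then have "\<not> inj_on ?g {..length w}"
      using False pigeonhole[of ?g "{..length w}"] by simp
    then obtain i j where ij: "i < j" "j \<le> length w" "?g i = ?g j"
      unfolding inj_on_def by (metis atMost_iff linorder_neqE_nat)
    let ?w = "take i w @ drop j w"
    have "foldl f s ?w = foldl f (?g j) (drop j w)" using ij by simp
    also have "\<dots> = foldl f s w" by (metis append_take_drop_id foldl_append)
    finally have eq: "foldl f s ?w = foldl f s w" .
    have "set ?w \<subseteq> A"
      using "1.prems" set_take_subset[of i w] set_drop_subset[of j w] by auto
    moreover have "length ?w < length w" using ij by simp
    ultimately obtain w' where "set w' \<subseteq> A" "length w' < card Q" "foldl f s w' = foldl f s ?w"
      using "1.IH" by blast
    then show ?thesis using eq by auto
  qed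
qed

section \<open>Values of arbitrary digit words, trailing zeros allowed\<close>

fun word_value :: "nat \<Rightarrow> nat list \<Rightarrow> nat" where
  "word_value k [] = 0"
| "word_value k (a # w) = a + k * word_value k w"

lemma word_value_base_expansion: "2 \<le> k \<Longrightarrow> word_value k (base_expansion k n) = n"
proof -
  assume "2 \<le> k"
  have "horner_sum id k w = word_value k w" for w
    by (induction w) simp_all
  then show ?thesis using base_expansion_canonical(2)[OF \<open>2 \<le> k\<close>] by simp
qed

lemma word_value_append:
  "word_value k (v @ w) = word_value k v + k ^ length v * word_value k w"
  by (induction v) (simp_all add: algebra_simps)

lemma word_value_less:
  assumes "set w \<subseteq> {..<k}"
  shows "word_value k w < k ^ length w"
  using assms
proof (induction w)
  case (Cons a w)
  then have "a < k" "word_value k w + 1 \<le> k ^ length w" by auto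
  then have "k * (word_value k w + 1) \<le> k * k ^ length w" by (intro mult_left_mono) auto
  with \<open>a < k\<close> show ?case by (simp add: algebra_simps)
qed simp

text \<open>The residue modulo \<open>k\<close> recovers the first letter. The lengths must agree
  because zeros at the end of a word do not change its value.\<close>

lemma word_value_inj:
  assumes "length v = length w" "set v \<subseteq> {..<k}" "set w \<subseteq> {..<k}"
    and "word_value k v = word_value k w"
  shows "v = w"
  using assms
proof (induction v w rule: list_induct2)
  case (Cons a v b w)
  then have less: "a < k" "b < k" by auto
  have eq: "a + k * word_value k v = b + k * word_value k w"
    using Cons.prems by simp
  have "(a + k * word_value k v) mod k = (b + k * word_value k w) mod k" using eq by simp
  then have "a = b" using less by simp
  with eq have "word_value k v = word_value k w" using less by simp
  with Cons \<open>a = b\<close> show ?case by auto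
qed simp

lemma length_base_expansion_le:
  assumes "2 \<le> k" "n < k ^ j"
  shows "length (base_expansion k n) \<le> j"
  using assms(2)
proof (induction j arbitrary: n)
  case (Suc j)
  then have "n div k < k ^ j" using assms(1) by (simp add: less_mult_imp_div_less mult.commute)
  then have "length (base_expansion k (n div k)) \<le> j" by (rule Suc.IH)
  then show ?case by (subst base_expansion.simps) simp
qed simp

section \<open>Residues and sums\<close>

lemma sum_list_mod_foldl:
  fixes D :: nat
  shows "foldl (\<lambda>r s. (r + s) mod D) (r mod D) xs = (r + sum_list xs) mod D"
proof (induction xs arbitrary: r)
  case (Cons a xs)
  have "foldl (\<lambda>r s. (r + s) mod D) (r mod D) (a # xs)
      = foldl (\<lambda>r s. (r + s) mod D) ((r + a) mod D) xs"
    by (simp add: mod_add_left_eq)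
  then show ?case using Cons[of "r + a"] by (simp add: add.assoc)
qed simp

text \<open>The numbers congruent to sums of members are closed under addition and under congruence
  modulo \<open>D\<close>. The least positive one divides every member, hence divides the gcd 1. For
  the length, \<open>foldl_shorten\<close> is applied to the partial sums modulo \<open>D\<close>,
  which take at most \<open>D\<close> values.\<close>

lemma sum_list_covers_residues:
  fixes D :: nat
  assumes "Gcd S = 1" "D > 0"
  shows "\<exists>xs. set xs \<subseteq> S \<and> length xs < D \<and> sum_list xs mod D = n mod D"
proof -
  define H where "H = {n. \<exists>xs. set xs \<subseteq> S \<and> sum_list xs mod D = n mod D}"
  have H_add: "x + y \<in> H" if "x \<in> H" "y \<in> H" for x y
  proof -
    from that obtain xs ys where xs: "set xs \<subseteq> S" "sum_list xs mod D = x mod D"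
      and ys: "set ys \<subseteq> S" "sum_list ys mod D = y mod D"
      unfolding H_def by blast
    have "sum_list (xs @ ys) mod D = (x + y) mod D"
      unfolding sum_list_append using xs(2) ys(2) by (rule mod_add_cong)
    then show ?thesis unfolding H_def using xs ys by (intro CollectI exI[of _ "xs @ ys"]) auto
  qed
  have H_0: "0 \<in> H" unfolding H_def by (intro CollectI exI[of _ "[]"]) auto
  have H_mult: "c * x \<in> H" if "x \<in> H" for c x
    by (induction c) (auto simp: H_0 intro: H_add that)
  have H_S: "s \<in> H" if "s \<in> S" for s
    unfolding H_def using that by (intro CollectI exI[of _ "[s]"]) auto
  have H_cong: "x \<in> H" if "y \<in> H" "x mod D = y mod D" for x y
    using that unfolding H_def by simp
  define g where "g = (LEAST n. 0 < n \<and> n \<in> H)"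
  have "0 < D \<and> D \<in> H" using assms(2) H_cong[OF H_0, of D] by simp
  from LeastI[of "\<lambda>n. 0 < n \<and> n \<in> H", OF this] have g: "0 < g" "g \<in> H"
    unfolding g_def by blast+
  have g_min: "g \<le> x" if "0 < x" "x \<in> H" for x
    unfolding g_def using that by (intro Least_le) simp
  have "g dvd s" if "s \<in> S" for s
  proof -
    \<comment> \<open>Division with remainder needs a subtraction, under which \<open>H\<close> is
      not visibly closed. Adding \<open>D - 1\<close> times \<open>(s div g) * g\<close> has the
      same effect modulo \<open>D\<close>.\<close>
    have "s mod g + D * ((s div g) * g) = s + (D - 1) * (s div g) * g"
    proof -
      have "D * ((s div g) * g) = (s div g) * g + (D - 1) * (s div g) * g"
        using assms(2) by (cases D) (auto simp: algebra_simps)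
      then show ?thesis using div_mult_mod_eq[of s g] by linarith
    qed
    moreover have "s + (D - 1) * (s div g) * g \<in> H"
      using H_add[OF H_S[OF that] H_mult[OF g(2)]] .
    ultimately have "s mod g + D * ((s div g) * g) \<in> H" by simp
    then have "s mod g \<in> H" by (rule H_cong) (simp only: mod_mult_self2)
    moreover have "s mod g < g" using g(1) by (rule mod_less_divisor)
    ultimately have "s mod g = 0" using g_min[of "s mod g"] by (cases "s mod g = 0") auto
    then show ?thesis by (rule mod_0_imp_dvd)
  qed
  then have "g dvd Gcd S" by (intro Gcd_greatest)
  then have "n \<in> H" using H_mult[OF g(2), of n] assms(1) by simp
  then obtain xs where xs: "set xs \<subseteq> S" "sum_list xs mod D = n mod D"
    unfolding H_def by blast
  let ?f = "\<lambda>r s. (r + s) mod D"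
  have "\<exists>xs'. set xs' \<subseteq> S \<and> length xs' < card {..<D} \<and> foldl ?f (0 mod D) xs' = foldl ?f (0 mod D) xs"
    using assms(2) xs(1) by (intro foldl_shorten) auto
  then obtain xs' where "set xs' \<subseteq> S" "length xs' < D"
    "foldl ?f (0 mod D) xs' = foldl ?f (0 mod D) xs" by auto
  with xs(2) show ?thesis unfolding sum_list_mod_foldl[where r = 0] by (intro exI[of _ xs']) simp
qed

section \<open>Sums of numbers with base-\<open>K\<close> digits 0 and 1\<close>

fun binary_digit_numbers :: "nat \<Rightarrow> nat \<Rightarrow> nat set" where
  "binary_digit_numbers K 0 = {0}"
| "binary_digit_numbers K (Suc n) =
     (\<lambda>e. K * e) ` binary_digit_numbers K n \<union> (\<lambda>e. 1 + K * e) ` binary_digit_numbers K n"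

text \<open>A digit \<open>r\<close> is a sum of \<open>r\<close> ones and \<open>K - 1 - r\<close>
  zeros, so all digits can be treated independently, without carries. The number of summands is
  exact because every summand will later carry a shift \<open>b n\<close>, whose total must be
  known.\<close>

lemma sum_binary_digit_numbers:
  assumes "K > 0" "e < K ^ n"
  shows "\<exists>xs. set xs \<subseteq> binary_digit_numbers K n \<and> length xs = K - 1 \<and> sum_list xs = e"
  using assms(2)
proof (induction n arbitrary: e)
  case 0
  then show ?case by (intro exI[of _ "replicate (K - 1) 0"]) (auto simp: sum_list_replicate)
next
  case (Suc n)
  then have "e div K < K ^ n" using assms(1) by (simp add: less_mult_imp_div_less mult.commute)
  then obtain ys where ys: "set ys \<subseteq> binary_digit_numbers K n" "length ys = K - 1"
    "sum_list ys = e div K" using Suc.IH by blast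
  let ?r = "e mod K"
  let ?xs = "map (\<lambda>e. 1 + K * e) (take ?r ys) @ map (\<lambda>e. K * e) (drop ?r ys)"
  have "?r < K" using assms(1) by (rule mod_less_divisor)
  then have "?r \<le> K - 1" by simp
  then have len: "length (take ?r ys) = ?r" using ys(2) by simp
  have sum_map: "sum_list (map (\<lambda>e. 1 + K * e) zs) = length zs + K * sum_list zs" for zs
    by (induction zs) (auto simp: algebra_simps)
  have "sum_list ?xs = ?r + K * (sum_list (take ?r ys) + sum_list (drop ?r ys))"
    unfolding sum_list_append sum_map len sum_list_const_mult by (simp only: list.map_ident distrib_left add.assoc)
  also have "sum_list (take ?r ys) + sum_list (drop ?r ys) = sum_list ys"
    by (metis append_take_drop_id sum_list_append)
  finally have "sum_list ?xs = e" using ys(3) by simp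
  moreover have "set ?xs \<subseteq> binary_digit_numbers K (Suc n)"
    using ys(1) by (auto dest!: in_set_takeD in_set_dropD)
  moreover have "length ?xs = K - 1" using ys(2) \<open>?r \<le> K - 1\<close> by simp
  ultimately show ?case by blast
qed

lemma sum_binary_digit_numbers_multiple:
  assumes "K > 0" "e \<le> R * (K ^ n - 1)"
  shows "\<exists>xs. set xs \<subseteq> binary_digit_numbers K n \<and> length xs = R * (K - 1) \<and> sum_list xs = e"
  using assms(2)
proof (induction R arbitrary: e)
  case (Suc R)
  \<comment> \<open>Greedy choice: \<open>K ^ n - 1\<close> is the most that one block of
    \<open>K - 1\<close> summands can contribute.\<close>
  define e' where "e' = min e (K ^ n - 1)"
  have "e' < K ^ n" using assms(1) by (simp add: e'_def min_less_iff_disj)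
  then obtain xs where xs: "set xs \<subseteq> binary_digit_numbers K n" "length xs = K - 1" "sum_list xs = e'"
    using sum_binary_digit_numbers assms(1) by blast
  have "e - e' \<le> R * (K ^ n - 1)" using Suc.prems by (auto simp: e'_def min_def)
  then obtain ys where ys: "set ys \<subseteq> binary_digit_numbers K n" "length ys = R * (K - 1)"
      "sum_list ys = e - e'"
    using Suc.IH by blast
  show ?case using xs ys by (intro exI[of _ "xs @ ys"]) (auto simp: e'_def)
qed auto

lemma sum_of_at_most_add:
  assumes "sum_of_at_most i S m" "sum_of_at_most j S n" "i + j \<le> l"
  shows "sum_of_at_most l S (m + n)"
proof -
  obtain xs ys where "set xs \<subseteq> S" "length xs \<le> i" "sum_list xs = m"
    "set ys \<subseteq> S" "length ys \<le> j" "sum_list ys = n"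
    using assms unfolding sum_of_at_most_def by blast
  then show ?thesis unfolding sum_of_at_most_def using assms(3)
    by (intro exI[of _ "xs @ ys"]) auto
qed

text \<open>For fixed \<open>n\<close> the sums of \<open>r D (K - 1)\<close> elements \<open>b + D e\<close> contain all \<open>D t\<close> with
  \<open>r X \<le> t \<le> r (X + D Z)\<close>, where \<open>X = (K - 1) b\<close> and \<open>Z = K ^ n - 1\<close>. Since \<open>X \<le> C Z\<close>,
  consecutive intervals overlap once \<open>r \<ge> C\<close>, and \<open>r \<le> 2 K C\<^sup>2\<close> reaches the range covered
  by \<open>n + 1\<close>.\<close>

lemma sum_of_digit_family:
  fixes b :: "nat \<Rightarrow> nat"
  assumes K: "K \<ge> 2" and D: "D > 0" and C: "C > 0"
    and bound: "\<And>n. n \<ge> 1 \<Longrightarrow> (K - 1) * b n \<le> C * (K ^ n - 1)"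
    and fam: "\<And>n e. e \<in> binary_digit_numbers K n \<Longrightarrow> b n + D * e \<in> S"
    and t: "t \<ge> C\<^sup>2 * K"
  shows "sum_of_at_most (2 * K\<^sup>2 * D * C\<^sup>2) S (D * t)"
proof -
  define Z where "Z n = K ^ n - 1" for n
  have step: "Z (Suc n) \<le> 2 * K * Z n" if "n \<ge> 1" for n
  proof -
    have "K ^ 1 \<le> K ^ n" using K that by (intro power_increasing) auto
    then have "K ^ n \<le> 2 * Z n" using K by (simp add: Z_def)
    then have "K * K ^ n \<le> K * (2 * Z n)" by (rule mult_left_mono) simp
    moreover have "Z (Suc n) \<le> K * K ^ n" by (simp add: Z_def)
    ultimately show ?thesis by (simp only: mult_ac)
  qed
  have Z_ge: "n \<le> Z n" for n
  proof -
    have "n < 2 ^ n" by (rule less_exp)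
    also have "(2::nat) ^ n \<le> K ^ n" using K by (intro power_mono) auto
    finally show ?thesis by (simp add: Z_def)
  qed
  let ?P = "\<lambda>n. 1 \<le> n \<and> C\<^sup>2 * Z n \<le> t"
  have "C\<^sup>2 * (K - 1) \<le> C\<^sup>2 * K" by (rule mult_le_mono2) simp
  then have "?P 1" using le_trans[OF _ t] by (simp add: Z_def)
  have P_le: "n \<le> t" if "?P n" for n
  proof -
    have "1 \<le> C\<^sup>2" using C by simp
    then have "1 * n \<le> C\<^sup>2 * Z n" using Z_ge[of n] by (rule mult_le_mono)
    then show ?thesis using that by simp
  qed
  \<comment> \<open>Membership in \<open>?P\<close> gives \<open>C * X \<le> t\<close>, so
    \<open>r = C\<close> does not overshoot. Maximality gives
    \<open>t < C\<^sup>2 * Z (Suc n)\<close>, which bounds the number of blocks. The hypothesis on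
    \<open>t\<close> makes \<open>n = 1\<close> admissible.\<close>
  define n where "n = (GREATEST n. ?P n)"
  have n_P: "?P n" unfolding n_def
    by (rule GreatestI_nat[where P = ?P, OF \<open>?P 1\<close>]) (use P_le in blast)
  have n_max: "n' \<le> n" if "?P n'" for n' unfolding n_def
    by (rule Greatest_le_nat[where P = ?P, OF that]) (use P_le in blast)
  define X where "X = (K - 1) * b n"
  define Y where "Y = X + D * Z n"
  have XZ: "X \<le> C * Z n" using bound[of n] n_P by (simp add: X_def Z_def)
  have "C * X \<le> C * (C * Z n)" by (rule mult_le_mono2[OF XZ])
  also have "\<dots> \<le> t" using n_P by (simp only: power2_eq_square mult.assoc)
  finally have tX: "C * X \<le> t" .
  have "\<not> ?P (Suc n)" using n_max[of "Suc n"] by auto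
  then have "t < C\<^sup>2 * Z (Suc n)" using n_P by simp
  also have "\<dots> \<le> C\<^sup>2 * (2 * K * Z n)" using step n_P by (intro mult_le_mono2) blast
  also have "\<dots> = 2 * K * C\<^sup>2 * (1 * Z n)" by (simp only: mult_ac mult_1)
  also have "\<dots> \<le> 2 * K * C\<^sup>2 * (D * Z n)"
    using D by (intro mult_le_mono2 mult_le_mono1) simp
  also have "\<dots> \<le> 2 * K * C\<^sup>2 * Y" by (simp add: Y_def)
  finally have tY: "t \<le> 2 * K * C\<^sup>2 * Y" by simp
  have "1 \<le> 2 * K * C" using K C by (simp add: Suc_le_eq)
  then have "1 * C \<le> 2 * K * C * C" by (rule mult_le_mono1)
  then have CR: "C \<le> 2 * K * C\<^sup>2" by (simp add: power2_eq_square mult.assoc)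
  \<comment> \<open>The intervals are \<open>r * X\<close> to \<open>r * Y\<close>. Minimality puts
    \<open>t\<close> beyond the upper end for \<open>r - 1\<close> unless \<open>r = C\<close>, and
    overlap then puts \<open>t\<close> above the lower end for \<open>r\<close>.\<close>
  define r where "r = (LEAST r. C \<le> r \<and> t \<le> r * Y)"
  have r: "C \<le> r \<and> t \<le> r * Y" unfolding r_def
    by (rule LeastI[of _ "2 * K * C\<^sup>2"]) (use tY CR in auto)
  have r_le: "r \<le> 2 * K * C\<^sup>2" unfolding r_def
    by (rule Least_le) (use tY CR in auto)
  have rX: "r * X \<le> t"
  proof (cases "r = C")
    case False
    then obtain r' where r': "r = Suc r'" "C \<le> r'" using r by (cases r) auto
    have "\<not> t \<le> r' * Y"
    proof
      assume "t \<le> r' * Y"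
      then have "r \<le> r'" unfolding r_def using r'(2) by (intro Least_le) simp
      then show False using r'(1) by simp
    qed
    have "C * Z n \<le> r' * (D * Z n)" using r'(2) D by (intro mult_le_mono) auto
    with XZ have "X \<le> r' * (D * Z n)" by (rule le_trans)
    then have "r * X \<le> r' * X + r' * (D * Z n)" unfolding r'(1) mult_Suc by linarith
    also have "\<dots> = r' * Y" by (simp add: Y_def algebra_simps)
    finally show ?thesis using \<open>\<not> t \<le> r' * Y\<close> by simp
  qed (use tX in simp)
  \<comment> \<open>With \<open>r * D\<close> blocks the shifts \<open>b n\<close> add up to
    \<open>D * (r * X)\<close>, a multiple of \<open>D\<close>; the digit part supplies the
    remaining \<open>t - r * X\<close>.\<close>
  have "t \<le> r * X + (r * D) * (K ^ n - 1)"
    using r by (simp add: Y_def Z_def distrib_left mult.assoc)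
  then have "t - r * X \<le> (r * D) * (K ^ n - 1)" by simp
  then obtain xs where xs: "set xs \<subseteq> binary_digit_numbers K n"
      "length xs = r * D * (K - 1)" "sum_list xs = t - r * X"
    using sum_binary_digit_numbers_multiple[of K "t - r * X" "r * D" n] K by auto
  let ?ys = "map (\<lambda>e. b n + D * e) xs"
  have "sum_list (map (\<lambda>e. b n + D * e) zs) = length zs * b n + D * sum_list zs" for zs
    by (induction zs) (auto simp: algebra_simps)
  then have "sum_list ?ys = D * (r * X) + D * (t - r * X)"
    using xs by (simp add: X_def mult_ac)
  also have "\<dots> = D * t" using rX by (simp flip: distrib_left)
  finally have "sum_list ?ys = D * t" .
  moreover have "set ?ys \<subseteq> S" using xs(1) fam by auto
  moreover have "length ?ys \<le> 2 * K\<^sup>2 * D * C\<^sup>2"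
  proof -
    have "length ?ys \<le> (2 * K * C\<^sup>2) * D * K"
      using r_le by (simp only: length_map xs(2)) (intro mult_le_mono, auto)
    then show ?thesis by (simp add: power2_eq_square mult_ac)
  qed
  ultimately show ?thesis unfolding sum_of_at_most_def by blast
qed

section \<open>Automata\<close>

locale base_automaton =
  fixes k :: nat and A :: dfa
  assumes base: "2 \<le> k" and dfa: "is_dfa k A"
begin

abbreviation run :: "nat \<Rightarrow> nat list \<Rightarrow> nat" where
  "run \<equiv> foldl (next_state A)"

definition reach :: "nat \<Rightarrow> nat set" where
  "reach q = run q ` lists {..<k}"

definition accepted :: "nat \<Rightarrow> nat \<Rightarrow> nat list set" where
  "accepted q n = {w \<in> lists {..<k}. length w = n \<and> run q w \<in> accepting A}"

text \<open>Only the first letters of two loops are compared, which suits counting letter by letter;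
  \<open>branching_loops\<close> derives two loops of equal length.\<close>

definition branching :: "nat \<Rightarrow> bool" where
  "branching q \<longleftrightarrow> (\<exists>a<k. \<exists>b<k. a \<noteq> b \<and> q \<in> reach (next_state A q a) \<and> q \<in> reach (next_state A q b))"

lemma next_state_less: "q < num_states A \<Longrightarrow> a < k \<Longrightarrow> next_state A q a < num_states A"
  using dfa by (simp add: is_dfa_def)

lemma init_less: "init_state A < num_states A"
  using dfa by (simp add: is_dfa_def)

lemma reach_less: "q < num_states A \<Longrightarrow> p \<in> reach q \<Longrightarrow> p < num_states A"
  unfolding reach_def using foldl_in[of q "{..<num_states A}" "{..<k}" "next_state A"] next_state_less
  by auto

lemma finite_reach: "q < num_states A \<Longrightarrow> finite (reach q)"
  using reach_less by (intro finite_subset[of "reach q" "{..<num_states A}"]) auto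

lemma reach_refl: "q \<in> reach q"
  unfolding reach_def by (intro image_eqI[of _ _ "[]"]) auto

lemma reach_run: "w \<in> lists {..<k} \<Longrightarrow> run q w \<in> reach q"
  unfolding reach_def by blast

lemma reach_trans:
  assumes "p \<in> reach q" "r \<in> reach p"
  shows "r \<in> reach q"
proof -
  obtain v w where "v \<in> lists {..<k}" "w \<in> lists {..<k}" "p = run q v" "r = run p w"
    using assms unfolding reach_def by blast
  then show ?thesis unfolding reach_def
    by (intro image_eqI[of _ _ "v @ w"]) auto
qed

lemma reach_next: "a < k \<Longrightarrow> next_state A q a \<in> reach q"
  using reach_run[of "[a]" q] by simp

lemma reach_short:
  assumes "q < num_states A" "p \<in> reach q"
  obtains w where "w \<in> lists {..<k}" "length w < num_states A" "run q w = p"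
proof -
  obtain w where w: "w \<in> lists {..<k}" "p = run q w" using assms(2) unfolding reach_def by blast
  then have "set w \<subseteq> {..<k}" by auto
  then obtain w' where "set w' \<subseteq> {..<k}" "length w' < card {..<num_states A}" "run q w' = run q w"
    using foldl_shorten[of "{..<num_states A}" q "{..<k}" "next_state A" w] assms(1) next_state_less
    by auto
  then show ?thesis using that[of w'] w(2) by auto
qed

section \<open>Polynomial growth without branching states\<close>

lemma finite_accepted: "finite (accepted q n)"
proof -
  have "accepted q n \<subseteq> {w. set w \<subseteq> {..<k} \<and> length w = n}"
    unfolding accepted_def by auto
  then show ?thesis using finite_lists_length_eq[of "{..<k}" n] finite_subset by blast
qed

text \<open>A run that meets no branching state has at most one letter at each state that keeps it inside
  the strongly connected component; every other letter strictly shrinks the reachable set.\<close>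

lemma card_accepted_le:
  assumes "q < num_states A"
    and "\<And>p. p \<in> reach q \<Longrightarrow> reach p \<inter> accepting A \<noteq> {} \<Longrightarrow> \<not> branching p"
  shows "card (accepted q n) \<le> (k * n + 1) ^ card (reach q)"
  using assms
proof (induction n arbitrary: q)
  case 0
  have "accepted q 0 \<subseteq> {[]}" unfolding accepted_def by auto
  then have "card (accepted q 0) \<le> card {[]::nat list}" by (intro card_mono) auto
  then show ?case by simp
next
  case (Suc n)
  show ?case
  proof (cases "accepted q (Suc n) = {}")
    case False
    let ?\<delta> = "next_state A q"
    define r where "r = card (reach q) - 1"
    have "0 < card (reach q)"
      using reach_refl[of q] finite_reach[OF Suc.prems(1)] by (auto simp: card_gt_0_iff)
    then have r: "card (reach q) = Suc r" by (simp add: r_def)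
    \<comment> \<open>Since some word is accepted from \<open>q\<close>, the assumption on branching
      applies to \<open>q\<close> itself.\<close>
    from False obtain w where "w \<in> lists {..<k}" "run q w \<in> accepting A"
      unfolding accepted_def by blast
    then have "reach q \<inter> accepting A \<noteq> {}" using reach_run by blast
    then have nb: "\<not> branching q" using Suc.prems(2) reach_refl by blast
    have IH: "card (accepted (?\<delta> a) n) \<le> (k * n + 1) ^ card (reach (?\<delta> a))" if "a < k" for a
      using Suc.prems that reach_trans[OF reach_next[OF that]]
      by (intro Suc.IH next_state_less) blast+
    \<comment> \<open>\<open>Y\<close> bounds the words after a letter that allows a return to
      \<open>q\<close>; there is at most one such letter. \<open>X\<close> bounds the words after
      any other letter, which loses \<open>q\<close> from the reachable set.\<close>
    define Y where "Y = (k * n + 1) ^ Suc r"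
    define X where "X = (k * n + 1) ^ r"
    have bound: "card (accepted (?\<delta> a) n) \<le> X + (if q \<in> reach (?\<delta> a) then Y else 0)" if "a < k" for a
    proof -
      have sub: "reach (?\<delta> a) \<subseteq> reach q" using reach_trans[OF reach_next[OF that]] by blast
      show ?thesis
      proof (cases "q \<in> reach (?\<delta> a)")
        case True
        have "card (reach (?\<delta> a)) \<le> Suc r"
          using card_mono[OF finite_reach[OF Suc.prems(1)] sub] r by simp
        then have "(k * n + 1) ^ card (reach (?\<delta> a)) \<le> Y"
          unfolding Y_def by (intro power_increasing) auto
        then show ?thesis using IH[OF that] True by simp
      next
        case False
        then have "reach (?\<delta> a) \<subset> reach q" using sub reach_refl by blast
        then have "card (reach (?\<delta> a)) < Suc r"
          using psubset_card_mono[OF finite_reach[OF Suc.prems(1)]] r by metis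
        then have "(k * n + 1) ^ card (reach (?\<delta> a)) \<le> X"
          unfolding X_def by (intro power_increasing) auto
        then show ?thesis using IH[OF that] False by simp
      qed
    qed
    have "accepted q (Suc n) \<subseteq> (\<Union>a<k. (#) a ` accepted (?\<delta> a) n)"
    proof
      fix w assume w: "w \<in> accepted q (Suc n)"
      then obtain a v where "w = a # v" unfolding accepted_def by (cases w) auto
      with w show "w \<in> (\<Union>a<k. (#) a ` accepted (?\<delta> a) n)"
        unfolding accepted_def by auto
    qed
    then have "card (accepted q (Suc n)) \<le> card (\<Union>a<k. (#) a ` accepted (?\<delta> a) n)"
      by (intro card_mono) (auto simp: finite_accepted)
    also have "\<dots> \<le> (\<Sum>a<k. card ((#) a ` accepted (?\<delta> a) n))"
      by (intro card_UN_le) simp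
    also have "\<dots> \<le> (\<Sum>a<k. card (accepted (?\<delta> a) n))"
      by (intro sum_mono card_image_le finite_accepted)
    also have "\<dots> \<le> (\<Sum>a<k. X + (if q \<in> reach (?\<delta> a) then Y else 0))"
      by (intro sum_mono bound) simp
    also have "\<dots> = k * X + card {a \<in> {..<k}. q \<in> reach (?\<delta> a)} * Y"
      by (simp add: sum.distrib sum.If_cases Int_def)
    also have "\<dots> \<le> k * X + 1 * Y"
    proof -
      have "card {a \<in> {..<k}. q \<in> reach (?\<delta> a)} \<le> 1"
        using nb unfolding branching_def by (subst card_le_Suc0_iff_eq[unfolded One_nat_def[symmetric]]) auto
      then show ?thesis by (intro add_left_mono mult_le_mono1)
    qed
    also have "\<dots> = (k * Suc n + 1) * X" by (simp add: X_def Y_def algebra_simps)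
    also have "\<dots> \<le> (k * Suc n + 1) * (k * Suc n + 1) ^ r"
      unfolding X_def by (intro mult_le_mono2 power_mono) auto
    finally show ?thesis by (simp add: r)
  qed simp
qed

text \<open>The two return paths may differ in length. Concatenating them in both orders equalizes
  the lengths, and the results still differ in their first letter, hence in value.\<close>

lemma branching_loops:
  assumes "branching q" "q < num_states A"
  obtains x y where "set x \<subseteq> {..<k}" "set y \<subseteq> {..<k}" "run q x = q" "run q y = q"
    "0 < length x" "length x \<le> 2 * num_states A" "length y = length x" "word_value k x < word_value k y"
proof -
  obtain a b where ab: "a < k" "b < k" "a \<noteq> b"
    "q \<in> reach (next_state A q a)" "q \<in> reach (next_state A q b)"
    using assms(1) unfolding branching_def by blast
  obtain v where v: "v \<in> lists {..<k}" "length v < num_states A" "run (next_state A q a) v = q"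
    using reach_short[OF next_state_less[OF assms(2) ab(1)] ab(4)] .
  obtain w where w: "w \<in> lists {..<k}" "length w < num_states A" "run (next_state A q b) w = q"
    using reach_short[OF next_state_less[OF assms(2) ab(2)] ab(5)] .
  define x where "x = (a # v) @ (b # w)"
  define y where "y = (b # w) @ (a # v)"
  have xy: "set x \<subseteq> {..<k}" "set y \<subseteq> {..<k}" "run q x = q" "run q y = q"
    "length y = length x" "0 < length x" "length x \<le> 2 * num_states A"
    using ab v w by (auto simp: x_def y_def)
  have "x \<noteq> y" using ab(3) by (simp add: x_def y_def)
  then have "word_value k x \<noteq> word_value k y"
    using word_value_inj[of x y k] xy by auto
  then consider "word_value k x < word_value k y" | "word_value k y < word_value k x" by linarith
  then show ?thesis
  proof cases
    case 1
    then show ?thesis using that[of x y] xy by simp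
  next
    case 2
    then show ?thesis using that[of y x] xy by metis
  qed
qed

text \<open>Each digit of \<open>e\<close> selects one block, \<open>x\<close> for 0 and
  \<open>y\<close> for 1. Taking \<open>x\<close> throughout gives the geometric sum; a
  \<open>y\<close> in block \<open>i\<close> adds the difference of the values, weighted by the
  \<open>i\<close>-th power of \<open>k ^ length x\<close>.\<close>

lemma loop_words:
  assumes "set x \<subseteq> {..<k}" "set y \<subseteq> {..<k}" "run q x = q" "run q y = q"
    and "length y = length x" "word_value k x \<le> word_value k y"
    and "e \<in> binary_digit_numbers (k ^ length x) n"
  shows "\<exists>z. set z \<subseteq> {..<k} \<and> run q z = q \<and> length z = length x * n \<and>
    word_value k z = word_value k x * (\<Sum>i<n. (k ^ length x) ^ i) + (word_value k y - word_value k x) * e"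
  using assms(7)
proof (induction n arbitrary: e)
  case 0
  then show ?case by (intro exI[of _ "[]"]) auto
next
  case (Suc n)
  let ?K = "k ^ length x" and ?a = "word_value k x" and ?d = "word_value k y - word_value k x"
  let ?G = "\<lambda>n. \<Sum>i<n. ?K ^ i"
  have G: "?G (Suc n) = 1 + ?K * ?G n"
    by (subst sum.lessThan_Suc_shift) (simp add: sum_distrib_left)
  from Suc.prems obtain c e' where e': "e' \<in> binary_digit_numbers ?K n" "e = c + ?K * e'" "c = 0 \<or> c = 1"
    by (auto simp del: One_nat_def)
  then obtain z where z: "set z \<subseteq> {..<k}" "run q z = q" "length z = length x * n"
    "word_value k z = ?a * ?G n + ?d * e'" using Suc.IH by blast
  define u where "u = (if c = 0 then x else y)"
  have u: "set u \<subseteq> {..<k}" "run q u = q" "length u = length x" "word_value k u = ?a + ?d * c"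
    using assms e'(3) by (auto simp: u_def)
  have "word_value k (u @ z) = ?a + ?d * c + ?K * (?a * ?G n + ?d * e')"
    using u z by (simp add: word_value_append)
  also have "\<dots> = ?a * ?G (Suc n) + ?d * e"
    unfolding G e'(2) by (simp only: algebra_simps)
  finally have value_uz: "word_value k (u @ z) = ?a * ?G (Suc n) + ?d * e" .
  have "set (u @ z) \<subseteq> {..<k}" "run q (u @ z) = q" "length (u @ z) = length x * Suc n"
    using u z by simp_all
  with value_uz show ?case by blast
qed

text \<open>The language consists of canonical expansions only, so any accepted word is the
  expansion of a member, and pumped words need no check for leading zeros of the number.\<close>

lemma accepted_value_in:
  assumes "recognizes k A S" "set w \<subseteq> {..<k}" "run (init_state A) w \<in> accepting A"
  shows "word_value k w \<in> S"
proof -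
  have "w \<in> dfa_language k A" using assms(2,3) by (auto simp: dfa_language_def)
  then obtain s where "s \<in> S" "w = base_expansion k s"
    using assms(1) by (auto simp: recognizes_def)
  then show ?thesis using word_value_base_expansion[OF base] by simp
qed

section \<open>Sparseness in the absence of branching\<close>

lemma base_expansion_accepted:
  assumes "recognizes k A S" "s \<in> S"
  shows "set (base_expansion k s) \<subseteq> {..<k}" "run (init_state A) (base_expansion k s) \<in> accepting A"
proof -
  have "base_expansion k s \<in> dfa_language k A" using assms by (simp add: recognizes_def)
  then show "set (base_expansion k s) \<subseteq> {..<k}" "run (init_state A) (base_expansion k s) \<in> accepting A"
    by (auto simp: dfa_language_def)
qed

text \<open>Members up to \<open>x\<close> have at most \<open>L\<close> digits, because
  \<open>2 ^ L \<le> k ^ L\<close>; the estimate for a single word length is summed over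
  \<open>0\<close> to \<open>L\<close>.\<close>

lemma counting_le:
  assumes rec: "recognizes k A S"
    and nb: "\<And>q. q \<in> reach (init_state A) \<Longrightarrow> reach q \<inter> accepting A \<noteq> {} \<Longrightarrow> \<not> branching q"
    and x: "x < 2 ^ L"
  shows "counting S x \<le> (L + 1) * (k * (L + 1)) ^ num_states A"
proof -
  let ?i = "init_state A" and ?m = "num_states A"
  let ?T = "{n \<in> S. real n \<le> x}"
  have inj: "inj_on (base_expansion k) ?T"
    by (rule inj_on_inverseI[of _ "word_value k"]) (simp add: word_value_base_expansion[OF base])
  have sub: "base_expansion k ` ?T \<subseteq> (\<Union>l\<in>{..L}. accepted ?i l)"
  proof clarify
    fix s assume s: "s \<in> S" "real s \<le> x"
    have "(2::nat) ^ L \<le> k ^ L" using base by (intro power_mono) auto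
    moreover have "real s < 2 ^ L" using s(2) x by (rule le_less_trans)
    then have "s < 2 ^ L" by simp
    ultimately have "s < k ^ L" by simp
    then have "length (base_expansion k s) \<le> L" by (rule length_base_expansion_le[OF base])
    then show "base_expansion k s \<in> (\<Union>l\<in>{..L}. accepted ?i l)"
      using base_expansion_accepted[OF rec s(1)] by (auto simp: accepted_def)
  qed
  have reach_card: "card (reach ?i) \<le> ?m"
  proof -
    have "reach ?i \<subseteq> {..<?m}" using reach_less[OF init_less] by auto
    then show ?thesis using card_mono[of "{..<?m}" "reach ?i"] by simp
  qed
  have "counting S x = card (base_expansion k ` ?T)"
    unfolding counting_def by (rule card_image[OF inj, symmetric])
  also have "\<dots> \<le> card (\<Union>l\<in>{..L}. accepted ?i l)"
    by (intro card_mono sub) (auto simp: finite_accepted)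
  also have "\<dots> \<le> (\<Sum>l\<in>{..L}. card (accepted ?i l))"
    by (intro card_UN_le) simp
  also have "\<dots> \<le> (\<Sum>l\<in>{..L}. (k * (L + 1)) ^ ?m)"
  proof (rule sum_mono)
    fix l assume "l \<in> {..L}"
    then have "k * l \<le> k * L" by (intro mult_le_mono2) simp
    then have "k * l + 1 \<le> k * L + k" using base by linarith
    then have "k * l + 1 \<le> k * (L + 1)" by simp
    then have "(k * l + 1) ^ card (reach ?i) \<le> (k * (L + 1)) ^ card (reach ?i)"
      by (intro power_mono) auto
    also have "\<dots> \<le> (k * (L + 1)) ^ ?m"
      using base reach_card by (intro power_increasing) auto
    finally have "(k * l + 1) ^ card (reach ?i) \<le> (k * (L + 1)) ^ ?m" .
    moreover have "card (accepted ?i l) \<le> (k * l + 1) ^ card (reach ?i)"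
      using nb by (intro card_accepted_le init_less) blast
    ultimately show "card (accepted ?i l) \<le> (k * (L + 1)) ^ ?m" by (rule le_trans[rotated])
  qed
  also have "\<dots> = (L + 1) * (k * (L + 1)) ^ ?m" by simp
  finally show ?thesis .
qed

lemma sparse_if_no_branching:
  assumes rec: "recognizes k A S"
    and nb: "\<And>q. q \<in> reach (init_state A) \<Longrightarrow> reach q \<inter> accepting A \<noteq> {} \<Longrightarrow> \<not> branching q"
  shows "sparse S"
proof -
  let ?m = "num_states A"
  let ?c = "4 * (real k * 4) ^ ?m"
  \<comment> \<open>From 3 on, \<open>ln x\<close> is at least 1 and absorbs additive
    constants.\<close>
  have "norm (real (counting S x)) \<le> ?c * norm (ln x ^ (?m + 1))" if x: "x \<ge> 3" for x :: real
  proof -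
    define L where "L = nat \<lfloor>log 2 x\<rfloor> + 1"
    have "ln (exp 1) \<le> ln x" using x exp_le by (subst ln_le_cancel_iff) auto
    then have ln1: "1 \<le> ln x" by simp
    have log0: "0 \<le> log 2 x" using x by simp
    have "log 2 x < real L" unfolding L_def using log0 by linarith
    then have "x < 2 powr real L" using x by (simp add: log_less_iff)
    then have "x < 2 ^ L" by (simp add: powr_realpow)
    then have "counting S x \<le> (L + 1) * (k * (L + 1)) ^ ?m"
      by (intro counting_le[OF rec]) (use nb in blast)+
    then have "real (counting S x) \<le> real ((L + 1) * (k * (L + 1)) ^ ?m)"
      by (simp only: of_nat_le_iff)
    also have "\<dots> = real (L + 1) * (real k * real (L + 1)) ^ ?m"
      by (simp only: of_nat_mult of_nat_power)
    also have "\<dots> \<le> (4 * ln x) * (real k * (4 * ln x)) ^ ?m"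
    proof -
      \<comment> \<open>Since \<open>exp 1\<close> is at most 4, \<open>ln 2\<close> is at least one
        half, so \<open>L + 1\<close> is at most \<open>2 * ln x + 2\<close>.\<close>
      have "ln (exp 1) \<le> ln ((2::real) ^ 2)" using exp_le by (subst ln_le_cancel_iff) auto
      then have "1 \<le> 2 * ln (2::real)" using ln_realpow[of "2::real" 2] by simp
      then have "1 * ln x \<le> 2 * ln 2 * ln x" using ln1 by (intro mult_right_mono) auto
      then have "log 2 x \<le> 2 * ln x" by (simp add: log_def divide_le_eq mult_ac)
      moreover have "real L \<le> log 2 x + 1" unfolding L_def using log0 by linarith
      ultimately have "real (L + 1) \<le> 4 * ln x" using ln1 by simp
      then show ?thesis using ln1 by (intro mult_mono power_mono) auto
    qed
    also have "\<dots> = ?c * ln x ^ (?m + 1)" by (simp add: power_mult_distrib)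
    finally show ?thesis using ln1 by simp
  qed
  then have "eventually (\<lambda>x. norm (real (counting S x)) \<le> ?c * norm (ln x ^ (?m + 1))) at_top"
    using eventually_ge_at_top[of "3::real"] by (rule eventually_mono[rotated])
  then have "(\<lambda>x. real (counting S x)) \<in> O(\<lambda>x. ln x ^ (?m + 1))" by (rule bigoI)
  then show ?thesis unfolding sparse_def by blast
qed

section \<open>Small members and small sums in prescribed residue classes\<close>

text \<open>The product of the automaton with counters modulo \<open>D\<close> for the value read so far and for the
  weight of the next digit has \<open>m D\<^sup>2\<close> states.\<close>

lemma small_representative:
  assumes rec: "recognizes k A S" and s: "s \<in> S" and D: "D > 0"
  shows "\<exists>s'\<in>S. s' < k ^ (num_states A * D\<^sup>2) \<and> s' mod D = s mod D"
proof -
  let ?m = "num_states A" and ?i = "init_state A"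
  define f where "f = (\<lambda>(q, v, p) a. (next_state A q a, (v + p * a) mod D, (p * k) mod D))"
  have foldl_f: "foldl f (q, v mod D, p mod D) w =
      (run q w, (v + p * word_value k w) mod D, (p * k ^ length w) mod D)" for q v p w
  proof (induction w arbitrary: q v p)
    case (Cons a w)
    have "(v mod D + p mod D * a) mod D = (v + p * a) mod D"
      by (rule mod_add_cong) (simp_all add: mod_mult_left_eq)
    then have "f (q, v mod D, p mod D) a = (next_state A q a, (v + p * a) mod D, (p * k) mod D)"
      by (simp only: f_def prod.case mod_mult_left_eq)
    then have "foldl f (q, v mod D, p mod D) (a # w) =
        foldl f (next_state A q a, (v + p * a) mod D, (p * k) mod D) w" by simp
    also have "\<dots> = (run (next_state A q a) w, (v + p * a + p * k * word_value k w) mod D,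
        (p * k * k ^ length w) mod D)" by (rule Cons.IH)
    finally show ?case by (simp add: distrib_left mult.assoc add.assoc)
  qed simp
  define Q where "Q = {..<?m} \<times> {..<D} \<times> {..<D}"
  have "card Q = ?m * D\<^sup>2" "finite Q" by (simp_all add: Q_def power2_eq_square)
  \<comment> \<open>The counters start with value 0 and weight 1, written as residues to match
    \<open>foldl_f\<close>; this also covers \<open>D = 1\<close>.\<close>
  let ?w = "base_expansion k s" and ?s0 = "(?i, 0 mod D, 1 mod D)"
  note w = base_expansion_accepted[OF rec s]
  have "\<exists>w'. set w' \<subseteq> {..<k} \<and> length w' < card Q \<and> foldl f ?s0 w' = foldl f ?s0 ?w"
    using \<open>finite Q\<close> w(1) D init_less next_state_less
    by (intro foldl_shorten) (auto simp: Q_def f_def)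
  then obtain w' where w': "set w' \<subseteq> {..<k}" "length w' < ?m * D\<^sup>2"
    "run ?i w' = run ?i ?w" "word_value k w' mod D = word_value k ?w mod D"
    unfolding foldl_f \<open>card Q = ?m * D\<^sup>2\<close> by auto
  have "word_value k w' \<in> S" using rec w'(1,3) w(2) by (intro accepted_value_in) auto
  moreover have "word_value k w' < k ^ (?m * D\<^sup>2)"
  proof -
    have "word_value k w' < k ^ length w'" using w'(1) by (rule word_value_less)
    also have "\<dots> \<le> k ^ (?m * D\<^sup>2)" using w'(2) base by (intro power_increasing) auto
    finally show ?thesis .
  qed
  ultimately show ?thesis using w'(4) word_value_base_expansion[OF base] by auto
qed

text \<open>Fewer than \<open>D\<close> members reach the residue; replacing each by a small member
  of its own class bounds the sum.\<close>

lemma small_residue_sum: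
  assumes rec: "recognizes k A S" and gcd: "Gcd S = 1" and D: "D > 0"
  shows "\<exists>y. sum_of_at_most D S y \<and> y \<le> D * k ^ (num_states A * D\<^sup>2) \<and> y mod D = n mod D"
proof -
  let ?b = "k ^ (num_states A * D\<^sup>2)"
  obtain xs where xs: "set xs \<subseteq> S" "length xs < D" "sum_list xs mod D = n mod D"
    using sum_list_covers_residues[OF gcd D] by blast
  have "\<exists>ys. set ys \<subseteq> S \<and> length ys = length xs \<and> sum_list ys \<le> length xs * ?b \<and>
      sum_list ys mod D = sum_list xs mod D" using xs(1)
  proof (induction xs)
    case (Cons x xs)
    then obtain ys where ys: "set ys \<subseteq> S" "length ys = length xs" "sum_list ys \<le> length xs * ?b"
      "sum_list ys mod D = sum_list xs mod D" by auto
    obtain y where y: "y \<in> S" "y < ?b" "y mod D = x mod D"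
      using small_representative[OF rec _ D] Cons.prems by (metis list.set_intros(1) subsetD)
    have "(y + sum_list ys) mod D = (x + sum_list xs) mod D"
      using y(3) ys(4) by (rule mod_add_cong)
    then show ?case using y ys by (intro exI[of _ "y # ys"]) auto
  qed auto
  then obtain ys where ys: "set ys \<subseteq> S" "length ys = length xs" "sum_list ys \<le> length xs * ?b"
    "sum_list ys mod D = sum_list xs mod D" by blast
  have "length xs * ?b \<le> D * ?b" using xs(2) by (intro mult_le_mono1) simp
  then have "sum_list ys \<le> D * ?b" using ys(3) by linarith
  moreover have "sum_of_at_most D S (sum_list ys)"
    unfolding sum_of_at_most_def using ys xs(2) by (intro exI[of _ ys]) auto
  ultimately show ?thesis using ys(4) xs(3) by auto
qed

text \<open>The members used are the values of \<open>u @ z @ w\<close>, where \<open>u\<close>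
  leads to a branching state, \<open>z\<close> runs through its two loops, and \<open>w\<close>
  leads to acceptance. They have the form \<open>b n + D * e\<close> required by
  \<open>sum_of_digit_family\<close>.\<close>

lemma basis_bound:
  assumes rec: "recognizes k A S" and nsp: "\<not> sparse S" and gcd: "Gcd S = 1"
  defines "B \<equiv> k ^ num_states A"
  assumes n: "n \<ge> B ^ 17 + B ^ 3 * B ^ B ^ 6"
  shows "sum_of_at_most (B ^ 21) S n"
proof -
  let ?m = "num_states A" and ?i = "init_state A"
  obtain q where q: "q \<in> reach ?i" "reach q \<inter> accepting A \<noteq> {}" "branching q"
    using sparse_if_no_branching[OF rec] nsp by blast
  have q_less: "q < ?m" using reach_less[OF init_less q(1)] .
  obtain u where u: "u \<in> lists {..<k}" "length u < ?m" "run ?i u = q"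
    using reach_short[OF init_less q(1)] .
  obtain p where "p \<in> reach q" "p \<in> accepting A" using q(2) by blast
  then obtain w where w: "w \<in> lists {..<k}" "length w < ?m" "run q w \<in> accepting A"
    using reach_short[OF q_less] by metis
  obtain x y where xy: "set x \<subseteq> {..<k}" "set y \<subseteq> {..<k}" "run q x = q" "run q y = q"
    "0 < length x" "length x \<le> 2 * ?m" "length y = length x" "word_value k x < word_value k y"
    using branching_loops[OF q(3) q_less] .
  define K where "K = k ^ length x"
  define L where "L = k ^ length u"
  define U where "U = word_value k u"
  define W where "W = word_value k w"
  define a where "a = word_value k x"
  define d where "d = word_value k y - word_value k x"
  define D where "D = L * d"
  \<comment> \<open>The three products are the contributions of \<open>u\<close>, the loops and
    \<open>w\<close> to \<open>(K - 1) * b n\<close>, measured in units of \<open>K ^ n - 1\<close>;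
    the factor 2 comes from \<open>K ^ n \<le> 2 * (K ^ n - 1)\<close>, and the final 1 makes
    \<open>C\<close> positive.\<close>
  define C where "C = U + L * a + 2 * K * L * W + 1"
  define G where "G n = (\<Sum>i<n. K ^ i)" for n
  define b where "b n = U + L * (a * G n + K ^ n * W)" for n
  have "?m > 0" using init_less by linarith
  have pow_le: "k ^ i \<le> B" if "i \<le> ?m" for i
    unfolding B_def using base that by (intro power_increasing) auto
  have B2: "2 \<le> B" using pow_le[of 1] base \<open>?m > 0\<close> by simp
  have K2: "2 \<le> K"
  proof -
    have "k ^ 1 \<le> k ^ length x" using xy(5) base
      by (intro power_increasing) (simp_all add: Suc_le_eq del: length_greater_0_conv)
    then show ?thesis using base by (simp add: K_def)
  qed
  have K_le: "K \<le> B ^ 2"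
  proof -
    have "K \<le> k ^ (2 * ?m)" unfolding K_def using base xy(6) by (intro power_increasing) auto
    then show ?thesis by (simp add: B_def power_mult[symmetric] mult.commute)
  qed
  have L_le: "L \<le> B" unfolding L_def using u(2) by (intro pow_le) simp
  have U_le: "U \<le> B"
  proof -
    have "U < L" unfolding U_def L_def using u(1) by (intro word_value_less) auto
    then show ?thesis using L_le by simp
  qed
  have W_le: "W \<le> B"
  proof -
    have "W < k ^ length w" unfolding W_def using w(1) by (intro word_value_less) auto
    also have "\<dots> \<le> B" using w(2) by (intro pow_le) simp
    finally show ?thesis by simp
  qed
  have a_le: "a \<le> B ^ 2"
  proof -
    have "a < K" unfolding a_def K_def using xy(1) by (rule word_value_less)
    then show ?thesis using K_le by simp
  qed
  have d_le: "d \<le> B ^ 2"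
  proof -
    have "word_value k y < k ^ length y" using xy(2) by (rule word_value_less)
    then have "word_value k y < K" by (simp only: xy(7) K_def)
    then have "d < K" unfolding d_def by linarith
    then show ?thesis using K_le by simp
  qed
  have D_pos: "D > 0" using xy(8) base by (simp add: D_def L_def d_def)
  have D_le: "D \<le> B ^ 3"
  proof -
    have "D \<le> B * B ^ 2" unfolding D_def using L_le d_le by (rule mult_le_mono)
    also have "\<dots> = B ^ 3" by (simp only: power_Suc[symmetric]) simp
    finally show ?thesis .
  qed
  have C_le: "C \<le> B ^ 6"
  proof -
    have "2 * B ^ 3 \<le> B * B ^ 3" using B2 by (rule mult_le_mono1)
    moreover have "B + 1 \<le> B ^ 3"
    proof -
      have "2 * B \<le> B * B" using B2 by (rule mult_le_mono1)
      moreover have "1 * (B * B) \<le> B * (B * B)" using B2 by (intro mult_le_mono1) simp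
      ultimately have "B + 1 \<le> B * (B * B)" using B2 by linarith
      then show ?thesis by (simp add: power3_eq_cube mult.assoc)
    qed
    moreover have "L * a \<le> B ^ 3"
    proof -
      have "L * a \<le> B * B ^ 2" using L_le a_le by (rule mult_le_mono)
      then show ?thesis by (simp add: power3_eq_cube power2_eq_square)
    qed
    moreover have "K * L * W \<le> B * B ^ 3"
    proof -
      have "K * L * W \<le> B ^ 2 * B * B" using K_le L_le W_le by (intro mult_le_mono)
      then show ?thesis by (simp add: power3_eq_cube power2_eq_square)
    qed
    ultimately have "C \<le> 4 * (B * B ^ 3)"
      unfolding C_def mult.assoc[of 2] using U_le by linarith
    also have "\<dots> \<le> (B * B) * (B * B ^ 3)"
      using mult_le_mono[OF B2 B2] by (intro mult_le_mono1) simp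
    also have "\<dots> = B ^ 6" by (simp add: eval_nat_numeral)
    finally show ?thesis .
  qed
  have geometric: "(K - 1) * G n = K ^ n - 1" for n
  proof -
    have "(K - 1) * G n + 1 = K ^ n"
    proof (induction n)
      case (Suc n)
      have "(K - 1) * G (Suc n) + 1 = (K - 1) * K ^ n + ((K - 1) * G n + 1)"
        by (simp add: G_def distrib_left)
      also have "\<dots> = (K - 1 + 1) * K ^ n" unfolding Suc by (simp only: distrib_right mult_1)
      finally show ?case using K2 by simp
    qed (simp add: G_def)
    then show ?thesis by linarith
  qed
  have bound: "(K - 1) * b n \<le> C * (K ^ n - 1)" if "n \<ge> 1" for n
  proof -
    define Z where "Z = K ^ n - 1"
    have "K ^ 1 \<le> K ^ n" using K2 that by (intro power_increasing) auto
    then have Z: "K - 1 \<le> Z" "K ^ n \<le> 2 * Z" using K2 by (simp_all add: Z_def)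
    have "(K - 1) * b n = (K - 1) * U + L * a * ((K - 1) * G n) + (K - 1) * (L * W) * K ^ n"
      by (simp only: b_def distrib_left mult_ac add.assoc)
    also have "(K - 1) * G n = Z" unfolding Z_def by (rule geometric)
    also have "(K - 1) * U + L * a * Z + (K - 1) * (L * W) * K ^ n \<le>
        Z * U + L * a * Z + K * (L * W) * (2 * Z)"
      using Z by (intro add_mono mult_le_mono) auto
    also have "\<dots> \<le> C * Z" by (simp add: C_def algebra_simps)
    finally show ?thesis by (simp only: Z_def)
  qed
  have family: "b n + D * e \<in> S" if e: "e \<in> binary_digit_numbers K n" for n e
  proof -
    obtain z where z: "set z \<subseteq> {..<k}" "run q z = q" "length z = length x * n"
      "word_value k z = a * G n + d * e"
      using loop_words[OF xy(1-4,7) less_imp_le[OF xy(8)] e[unfolded K_def]]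
      unfolding a_def d_def G_def K_def by blast
    have "k ^ length z = K ^ n" by (simp add: z(3) K_def power_mult)
    then have "word_value k (u @ z @ w) = U + L * (a * G n + d * e + K ^ n * W)"
      by (simp add: word_value_append U_def L_def W_def z(4))
    also have "\<dots> = b n + D * e" by (simp add: b_def D_def algebra_simps)
    finally have "word_value k (u @ z @ w) = b n + D * e" .
    moreover have "word_value k (u @ z @ w) \<in> S"
      using u w z by (intro accepted_value_in[OF rec]) auto
    ultimately show ?thesis by simp
  qed
  obtain r where r: "sum_of_at_most D S r" "r \<le> D * k ^ (?m * D\<^sup>2)" "r mod D = n mod D"
    using small_residue_sum[OF rec gcd D_pos] by blast
  have "r \<le> B ^ 3 * B ^ B ^ 6"
  proof -
    have "D\<^sup>2 \<le> (B ^ 3)\<^sup>2" using D_le by (intro power_mono) auto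
    then have "D\<^sup>2 \<le> B ^ 6" by (simp flip: power_mult)
    then have "B ^ D\<^sup>2 \<le> B ^ B ^ 6" using B2 by (intro power_increasing) auto
    then have "D * B ^ D\<^sup>2 \<le> B ^ 3 * B ^ B ^ 6" using D_le by (intro mult_le_mono)
    then show ?thesis using r(2) by (simp add: B_def flip: power_mult)
  qed
  \<comment> \<open>After the residue is corrected by \<open>r\<close>, at least
    \<open>B ^ 17\<close> remains. The exponent is \<open>3 + 2 * 6 + 2\<close>, from the bounds on
    \<open>D\<close>, \<open>C\<close> squared and \<open>K\<close>.\<close>
  with n have rn: "r + B ^ 17 \<le> n" by linarith
  then have "D dvd n - r" using r(3) mod_eq_dvd_iff_nat[of r n D] by simp
  then obtain t where t: "n - r = D * t" by (rule dvdE)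
  have "C\<^sup>2 * K \<le> t"
  proof -
    have "D * (C\<^sup>2 * K) \<le> B ^ 3 * ((B ^ 6)\<^sup>2 * B ^ 2)"
      using D_le C_le K_le by (intro mult_le_mono power_mono) auto
    also have "\<dots> = B ^ 17" by (simp flip: power_mult power_add)
    also have "\<dots> \<le> D * t" using rn t by linarith
    finally show ?thesis using D_pos by simp
  qed
  then have "sum_of_at_most (2 * K\<^sup>2 * D * C\<^sup>2) S (D * t)"
    using K2 D_pos bound family by (intro sum_of_digit_family[where b = b]) (auto simp: C_def)
  moreover have "2 * K\<^sup>2 * D * C\<^sup>2 + D \<le> B ^ 21"
  proof -
    \<comment> \<open>The exponents add up to \<open>2 * 2 + 3 + 2 * 6 = 19\<close>. The factor 2
      costs one more power of \<open>B\<close>, and the \<open>D\<close> summands for the residue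
      another.\<close>
    have "K\<^sup>2 * D * C\<^sup>2 \<le> (B ^ 2)\<^sup>2 * B ^ 3 * (B ^ 6)\<^sup>2"
      using D_le C_le K_le by (intro mult_le_mono power_mono) auto
    also have "\<dots> = B ^ 19" by (simp flip: power_mult power_add)
    finally have "2 * (K\<^sup>2 * D * C\<^sup>2) \<le> B * B ^ 19" using B2 by (intro mult_le_mono)
    moreover have "B ^ 3 \<le> B ^ 20" using B2 by (intro power_increasing) auto
    moreover have "2 * B ^ 20 \<le> B * B ^ 20" using B2 by (rule mult_le_mono1)
    moreover have "B * B ^ 19 = B ^ 20" "B * B ^ 20 = B ^ 21" by (simp_all flip: power_Suc)
    ultimately show ?thesis using D_le unfolding mult.assoc by linarith
  qed
  ultimately have "sum_of_at_most (B ^ 21) S (D * t + r)"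
    using r(1) by (intro sum_of_at_most_add)
  moreover have "D * t + r = n" using t rn by linarith
  ultimately show ?thesis by simp
qed

end

section \<open>Necessity\<close>

lemma Gcd_dvd_sum_list: "set xs \<subseteq> S \<Longrightarrow> Gcd S dvd sum_list xs" for S :: "nat set"
  by (induction xs) auto

text \<open>The gcd divides two consecutive large numbers.\<close>

lemma asymptotic_additive_basis_Gcd:
  assumes "asymptotic_additive_basis S"
  shows "Gcd S = 1"
proof -
  obtain j M where "\<And>n. n \<ge> M \<Longrightarrow> sum_of_at_most j S n"
    using assms unfolding asymptotic_additive_basis_def eventually_sequentially by blast
  then have "Gcd S dvd n" if "n \<ge> M" for n
    using that Gcd_dvd_sum_list unfolding sum_of_at_most_def by blast
  from this[of M] this[of "M + 1"] show ?thesis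
    by (metis dvd_add_right_iff le_add1 nat_dvd_1_iff_1 order_refl)
qed

text \<open>Padding with zeros turns every representation of a number in \<open>{M<..N}\<close> into
  a list of length exactly \<open>j\<close> over the members up to \<open>N\<close> together with 0,
  and these lists are counted.\<close>

lemma counting_lower_bound:
  assumes "\<And>n. n \<ge> M \<Longrightarrow> sum_of_at_most j S n"
  shows "N - M \<le> (counting S (real N) + 1) ^ j"
proof -
  let ?T = "{s \<in> S. real s \<le> real N}"
  let ?X = "{xs. set xs \<subseteq> insert 0 ?T \<and> length xs = j}"
  have fin: "finite ?T" by (rule finite_subset[of _ "{..N}"]) auto
  have "{M<..N} \<subseteq> sum_list ` ?X"
  proof
    fix n assume n: "n \<in> {M<..N}"
    then obtain xs where xs: "set xs \<subseteq> S" "length xs \<le> j" "sum_list xs = n"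
      using assms[of n] unfolding sum_of_at_most_def by auto
    let ?ys = "xs @ replicate (j - length xs) 0"
    have "s \<le> N" if "s \<in> set xs" for s
      using member_le_sum_list[OF that] xs(3) n by simp
    then have "?ys \<in> ?X" using xs by auto
    moreover have "n = sum_list ?ys" using xs(3) by (simp add: sum_list_replicate)
    ultimately show "n \<in> sum_list ` ?X" by (rule rev_image_eqI)
  qed
  then have "card {M<..N} \<le> card (sum_list ` ?X)"
    using fin by (intro card_mono finite_imageI finite_lists_length_eq) auto
  also have "\<dots> \<le> card ?X" using fin by (intro card_image_le finite_lists_length_eq) auto
  also have "\<dots> = card (insert 0 ?T) ^ j" using fin by (intro card_lists_length_eq) auto
  also have "\<dots> \<le> (counting S (real N) + 1) ^ j"
    unfolding counting_def using card_insert_le_m1[of "card ?T + 1" ?T 0] by (intro power_mono) auto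
  finally show ?thesis by simp
qed

lemma asymptotic_additive_basis_not_sparse:
  assumes "asymptotic_additive_basis S"
  shows "\<not> sparse S"
proof
  assume "sparse S"
  then obtain d where "(\<lambda>x. real (counting S x)) \<in> O(\<lambda>x. ln x ^ d)"
    unfolding sparse_def by blast
  then obtain c where c: "c > 0"
    "eventually (\<lambda>x. norm (real (counting S x)) \<le> c * norm (ln x ^ d)) at_top"
    by (rule landau_o.bigE)
  obtain j M where basis: "\<And>n. n \<ge> M \<Longrightarrow> sum_of_at_most j S n"
    using assms unfolding asymptotic_additive_basis_def eventually_sequentially by blast
  have "((\<lambda>x. ln x ^ (d * j) / exp (ln x)) \<longlongrightarrow> (0::real)) at_top"
    using filterlim_compose[OF tendsto_power_div_exp_0 ln_at_top] .
  then have "eventually (\<lambda>x::real. ln x ^ (d * j) / exp (ln x) < 1 / (2 * (c + 1) ^ j)) at_top"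
    using c(1) by (intro order_tendstoD(2)) auto
  \<comment> \<open>The choice \<open>x > 2 * real M\<close> makes \<open>N - M\<close> exceed half
    of \<open>N\<close>, while the last bound keeps the number of lists below that half.\<close>
  then have "eventually (\<lambda>x::real. x > 2 * real M \<and> x \<ge> 3 \<and>
      norm (real (counting S x)) \<le> c * norm (ln x ^ d) \<and>
      ln x ^ (d * j) / exp (ln x) < 1 / (2 * (c + 1) ^ j)) at_top"
    by (intro eventually_conj eventually_gt_at_top eventually_ge_at_top c(2))
  then have "eventually (\<lambda>n::nat. real n > 2 * real M \<and> real n \<ge> 3 \<and>
      norm (real (counting S (real n))) \<le> c * norm (ln (real n) ^ d) \<and>
      ln (real n) ^ (d * j) / exp (ln (real n)) < 1 / (2 * (c + 1) ^ j)) sequentially"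
    using filterlim_real_sequentially unfolding filterlim_iff by blast
  then obtain N :: nat where N: "real N > 2 * real M" "real N \<ge> 3"
    "norm (real (counting S (real N))) \<le> c * norm (ln (real N) ^ d)"
    "ln (real N) ^ (d * j) / exp (ln (real N)) < 1 / (2 * (c + 1) ^ j)"
    unfolding eventually_sequentially by blast
  have "ln (exp 1) \<le> ln (real N)" using N(2) exp_le by (subst ln_le_cancel_iff) auto
  then have ln1: "1 \<le> ln (real N)" by simp
  have "real (N - M) \<le> real ((counting S (real N) + 1) ^ j)"
    using counting_lower_bound[OF basis] by (simp only: of_nat_le_iff)
  also have "\<dots> = (real (counting S (real N)) + 1) ^ j" by (simp add: add.commute)
  \<comment> \<open>Raising \<open>c\<close> to \<open>c + 1\<close> absorbs the added 1, as
    \<open>ln (real N)\<close> is at least 1.\<close>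
  also have "\<dots> \<le> ((c + 1) * ln (real N) ^ d) ^ j"
  proof (rule power_mono)
    have "real (counting S (real N)) \<le> c * ln (real N) ^ d" using N(3) ln1 by simp
    then show "real (counting S (real N)) + 1 \<le> (c + 1) * ln (real N) ^ d"
      using one_le_power[OF ln1, of d] unfolding distrib_right mult_1 by linarith
  qed simp
  also have "\<dots> = (c + 1) ^ j * ln (real N) ^ (d * j)" by (simp add: power_mult_distrib power_mult)
  also have "\<dots> < real N / 2"
    using N(2,4) c(1) by (simp add: field_simps)
  finally show False using N(1) by linarith
qed

section \<open>Computing the bounds\<close>

fun const_rec :: "nat \<Rightarrow> recf" where
  "const_rec 0 = Zero"
| "const_rec (Suc n) = Comp Succ [const_rec n]"

definition add_rec :: recf where
  "add_rec = Prim (Proj 0) (Comp Succ [Proj 1])"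

definition mult_rec :: recf where
  "mult_rec = Prim Zero (Comp add_rec [Proj 1, Proj 2])"

text \<open>Primitive recursion runs on the first argument, so the exponent comes first;
  \<open>pow_rec\<close> restores the usual order. In the recursion step \<open>Proj 1\<close> is
  the previous value.\<close>

definition power_rec :: recf where
  "power_rec = Prim (const_rec 1) (Comp mult_rec [Proj 1, Proj 2])"

lemma rec_eval_proj: "i < length xs \<Longrightarrow> xs ! i = y \<Longrightarrow> rec_eval (Proj i) xs y"
  using rec_eval.proj by blast

lemma rec_eval_comp1: "rec_eval g xs a \<Longrightarrow> rec_eval f [a] y \<Longrightarrow> rec_eval (Comp f [g]) xs y"
  by (rule rec_eval.comp[where ys = "[a]"]) auto

lemma rec_eval_comp2:
  "rec_eval g xs a \<Longrightarrow> rec_eval h xs b \<Longrightarrow> rec_eval f [a, b] y \<Longrightarrow> rec_eval (Comp f [g, h]) xs y"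
  by (rule rec_eval.comp[where ys = "[a, b]"]) auto

lemma rec_eval_const: "rec_eval (const_rec n) xs n"
  by (induction n) (auto intro: rec_eval.zero rec_eval.succ rec_eval_comp1)

lemma rec_eval_add: "rec_eval add_rec [m, n] (m + n)"
  unfolding add_rec_def
proof (induction m)
  case 0
  show ?case by (rule rec_eval.prim_0) (simp add: rec_eval_proj)
next
  case (Suc m)
  then show ?case
    by (rule rec_eval.prim_Suc) (rule rec_eval_comp1[OF rec_eval_proj[OF _ refl]], auto intro: rec_eval.succ)
qed

lemma rec_eval_mult: "rec_eval mult_rec [m, n] (m * n)"
  unfolding mult_rec_def
proof (induction m)
  case 0
  show ?case by (simp add: rec_eval.prim_0 rec_eval.zero)
next
  case (Suc m)
  then show ?case
  proof (rule rec_eval.prim_Suc)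
    show "rec_eval (Comp add_rec [Proj 1, Proj 2]) [m, m * n, n] (Suc m * n)"
      using rec_eval_add[of "m * n" n] by (intro rec_eval_comp2 rec_eval_proj) (auto simp: add.commute)
  qed
qed

lemma rec_eval_power: "rec_eval power_rec [m, n] (n ^ m)"
  unfolding power_rec_def
proof (induction m)
  case 0
  show ?case using rec_eval_const[of 1 "[n]"] by (simp add: rec_eval.prim_0)
next
  case (Suc m)
  then show ?case
  proof (rule rec_eval.prim_Suc)
    show "rec_eval (Comp mult_rec [Proj 1, Proj 2]) [m, n ^ m, n] (n ^ Suc m)"
      using rec_eval_mult[of "n ^ m" n] by (intro rec_eval_comp2 rec_eval_proj) (auto simp: mult.commute)
  qed
qed

definition pow_rec :: "recf \<Rightarrow> recf \<Rightarrow> recf" where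
  "pow_rec f g = Comp power_rec [g, f]"

lemma rec_eval_pow_rec: "rec_eval f xs a \<Longrightarrow> rec_eval g xs b \<Longrightarrow> rec_eval (pow_rec f g) xs (a ^ b)"
  unfolding pow_rec_def using rec_eval_power by (rule rec_eval_comp2[rotated 2])

text \<open>The bounds of \<open>basis_bound\<close> are functions of the base and the number of
  states, the first two entries of \<open>dfa_input\<close>, so one pair of recursive functions
  serves all inputs.\<close>

lemma effective_bounds:
  "\<exists>f g. \<forall>k m xs. rec_eval f (k # m # xs) ((k ^ m) ^ 17 + (k ^ m) ^ 3 * (k ^ m) ^ (k ^ m) ^ 6) \<and>
     rec_eval g (k # m # xs) ((k ^ m) ^ 21)"
proof -
  let ?B = "pow_rec (Proj 0) (Proj 1)"
  let ?c = const_rec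
  have B: "rec_eval ?B (k # m # xs) (k ^ m)" for k m xs
    by (intro rec_eval_pow_rec rec_eval_proj) auto
  note intros = rec_eval_pow_rec[OF B rec_eval_const] rec_eval_pow_rec[OF B] rec_eval_mult rec_eval_add
  show ?thesis
    by (rule exI[of _ "Comp add_rec [pow_rec ?B (?c 17),
            Comp mult_rec [pow_rec ?B (?c 3), pow_rec ?B (pow_rec ?B (?c 6))]]"],
        rule exI[of _ "pow_rec ?B (?c 21)"], intro allI conjI)
      (rule rec_eval_comp2 intros)+
qed

theorem theorem1p1:
  "(\<forall>k S. 2 \<le> k \<longrightarrow> automatic k S \<longrightarrow>
      (asymptotic_additive_basis S \<longleftrightarrow> \<not> sparse S \<and> Gcd S = 1)) \<and>
   (\<exists>f g. \<forall>k A S. 2 \<le> k \<longrightarrow> recognizes k A S \<longrightarrow> \<not> sparse S \<longrightarrow> Gcd S = 1 \<longrightarrow>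
      (\<exists>M N. rec_eval f (dfa_input k A) M \<and> rec_eval g (dfa_input k A) N \<and>
         (\<forall>n\<ge>M. sum_of_at_most N S n)))"
proof -
  \<comment> \<open>This single explicit bound yields both the sufficiency direction and the
    effective statement.\<close>
  have bound: "\<forall>n \<ge> (k ^ m) ^ 17 + (k ^ m) ^ 3 * (k ^ m) ^ (k ^ m) ^ 6. sum_of_at_most ((k ^ m) ^ 21) S n"
    if "2 \<le> k" "recognizes k A S" "\<not> sparse S" "Gcd S = 1" "m = num_states A" for k A S m
  proof -
    have "base_automaton k A" using that by unfold_locales (auto simp: recognizes_def)
    then show ?thesis using base_automaton.basis_bound that by blast
  qed
  show ?thesis
  proof (intro conjI allI impI)
    fix k S assume k: "2 \<le> k" and "automatic k S"
    then obtain A where A: "recognizes k A S" unfolding automatic_def by blast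
    show "asymptotic_additive_basis S \<longleftrightarrow> \<not> sparse S \<and> Gcd S = 1"
    proof
      assume "\<not> sparse S \<and> Gcd S = 1"
      with bound[OF k A _ _ refl] show "asymptotic_additive_basis S"
        unfolding asymptotic_additive_basis_def eventually_sequentially by blast
    qed (simp add: asymptotic_additive_basis_Gcd asymptotic_additive_basis_not_sparse)
  next
    obtain f g where fg:
      "\<And>k m xs. rec_eval f (k # m # xs) ((k ^ m) ^ 17 + (k ^ m) ^ 3 * (k ^ m) ^ (k ^ m) ^ 6)"
      "\<And>k m xs. rec_eval g (k # m # xs) ((k ^ m) ^ 21)"
      using effective_bounds by blast
    show "\<exists>f g. \<forall>k A S. 2 \<le> k \<longrightarrow> recognizes k A S \<longrightarrow> \<not> sparse S \<longrightarrow> Gcd S = 1 \<longrightarrow>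
      (\<exists>M N. rec_eval f (dfa_input k A) M \<and> rec_eval g (dfa_input k A) N \<and>
         (\<forall>n\<ge>M. sum_of_at_most N S n))"
    proof (rule exI[of _ f], rule exI[of _ g], intro allI impI)
      fix k A S assume "2 \<le> k" "recognizes k A S" "\<not> sparse S" "Gcd S = 1"
      from bound[OF this refl] show "\<exists>M N. rec_eval f (dfa_input k A) M \<and>
          rec_eval g (dfa_input k A) N \<and> (\<forall>n\<ge>M. sum_of_at_most N S n)"
        unfolding dfa_input_def using fg by blast
    qed
  qed
qed

end
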